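(* Let $U^0\in\mathcal X$ with $\|U^0(\mathbf x)\|_F\le\sqrt m$ for all $\mathbf x\in\overline\Omega$, and let $\kappa\ge\max\{\tfrac32 m-1,\,2\}$. Then the ETD1 scheme $$U^{n+1}=e^{(\mathcal L-\kappa)\tau}U^n+\int_0^\tau e^{(\mathcal L-\kappa)(\tau-s)}\mathcal N[U^n]\,ds,\qquad n\ge0,$$ preserves the discrete maximum bound principle unconditionally: for every time step size $\tau>0$ and every $n\ge1$, $\|U^n(\mathbf x)\|_F\le\sqrt m$ for all $\mathbf x\in\overline\Omega$.
   Context: Let $m\ge2$ be an integer, $\Omega=[-\frac12,\frac12]^m$, $\varepsilon>0$ and $\kappa>0$ constants. $\|\cdot\|_F$ is the Frobenius norm on $\mathbb R^{m\times m}$. $\mathcal X$ is the Banach space of continuous $\mathbb R^{m\times m}$-valued functions on $\overline\Omega$ satisfying the periodic boundary condition (i.e. whose periodic extension to $\mathbb R^m$ is continuous), with norm $\|W\|_{\mathcal X}=\max_{\mathbf x\in\overline\Omega}\|W(\mathbf x)\|_F$. $\mathcal L=\varepsilon^2\Delta$ with periodic boundary condition, acting entrywise; $e^{t\mathcal L}=e^{t\varepsilon^2\Delta}$ ($t\ge0$) is the periodic heat semigroup on $\mathcal X$, acting entrywise, and $e^{(\mathcal L-\kappa)t}=e^{-\kappa t}e^{t\mathcal L}$. The nonlinearity acts pointwise: $\mathcal N[U]=\kappa U+f(U)$ with $f(U)=U-UU^{\mathrm T}U$. The scheme is a time discretization of $U_t=\varepsilon^2\Delta U+f(U)$ with initial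 value $U^0$. *)

theory Defs
  imports "HOL-Analysis.Analysis"
begin

section \<open>Matrix-valued periodic functions\<close>

text \<open>
  The dimension \<open>m\<close> is \<open>CARD('m)\<close>.  The library norm on \<open>real ^ 'm ^ 'm\<close> is the Frobenius norm.
\<close>

lemma norm_matrix_eq_frobenius:
  fixes A :: "real ^ 'm ^ 'n"
  shows "norm A = sqrt (\<Sum>i\<in>UNIV. \<Sum>j\<in>UNIV. (A $ i $ j)\<^sup>2)"
  by (simp add: norm_vec_def L2_set_def sum_nonneg)

definition \<Omega> :: "(real ^ 'm) set" where
  "\<Omega> = cbox (\<chi> i. - 1 / 2) (\<chi> i. 1 / 2)"

type_synonym 'm matfun = "(real ^ 'm) \<Rightarrow>\<^sub>C (real ^ 'm ^ 'm)"

instance bcontfun :: (metric_space, banach) banach ..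

text \<open>
  A function on \<open>\<Omega>\<close> satisfying the periodic boundary condition is identified with its continuous
  periodic extension to the whole space.  By lemma \<open>norm_periodic_matfun\<close> below, the norm of the type
  of bounded continuous functions is, on this subspace, the maximum over \<open>\<Omega>\<close>.
\<close>

definition periodic_matfun :: "'m::finite matfun set" where
  "periodic_matfun = {W :: 'm matfun. \<forall>x i. W (x + axis i 1) = W x}"

lemma periodic_matfun_of_int:
  fixes W :: "'m::finite matfun"
  assumes W: "W \<in> periodic_matfun"
  shows "W (x + of_int k *\<^sub>R axis i 1) = W x"
proof -
  have step: "W (y + axis i 1) = W y" for y
    using W by (simp add: periodic_matfun_def)
  show ?thesis
  proof (induction k rule: int_induct[where k = 0])
    case base
    show ?case by simp
  next
    case (step1 k)
    show ?case
      using step[of "x + of_int k *\<^sub>R axis i 1"] step1 by (simp add: algebra_simps)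
  next
    case (step2 k)
    show ?case
      using step[of "x + of_int (k - 1) *\<^sub>R axis i 1"] step2 by (simp add: algebra_simps)
  qed
qed

lemma periodic_matfun_sum:
  fixes W :: "'m::finite matfun" and k :: "'m \<Rightarrow> int"
  assumes W: "W \<in> periodic_matfun" and "finite I"
  shows "W (x + (\<Sum>i\<in>I. of_int (k i) *\<^sub>R axis i 1)) = W x"
  using \<open>finite I\<close>
proof (induction I)
  case (insert i I)
  then show ?case
    using periodic_matfun_of_int[OF W, of "x + (\<Sum>i\<in>I. of_int (k i) *\<^sub>R axis i 1)" "k i" i]
    by (simp add: algebra_simps)
qed simp

lemma periodic_matfun_representative:
  fixes W :: "'m::finite matfun"
  assumes W: "W \<in> periodic_matfun"
  shows "\<exists>y\<in>\<Omega>. W y = W x"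
proof -
  define y where "y = x + (\<Sum>i\<in>UNIV. of_int (- round (x $ i)) *\<^sub>R axis i 1)"
  have y: "y $ j = x $ j - of_int (round (x $ j))" for j
    by (simp add: y_def axis_def if_distrib cong: if_cong)
  have "\<bar>y $ j\<bar> \<le> 1 / 2" for j
    using of_int_round_abs_le[of "x $ j"] by (simp add: y abs_minus_commute)
  then have "- 1 / 2 \<le> y $ j \<and> y $ j \<le> 1 / 2" for j
    by (smt (verit) minus_divide_left)
  then have "y \<in> \<Omega>"
    by (simp add: \<Omega>_def mem_box_cart)
  moreover have "W y = W x"
    unfolding y_def by (rule periodic_matfun_sum[OF W]) simp
  ultimately show ?thesis by blast
qed

lemma norm_periodic_matfun:
  fixes W :: "'m::finite matfun"
  assumes W: "W \<in> periodic_matfun"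
  shows "\<exists>x\<in>\<Omega>. norm (W x) = norm W \<and> (\<forall>y\<in>\<Omega>. norm (W y) \<le> norm W)"
proof -
  have "compact (\<Omega> :: (real ^ 'm) set)"
    unfolding \<Omega>_def by (rule compact_cbox)
  moreover have "(\<Omega> :: (real ^ 'm) set) \<noteq> {}"
    using periodic_matfun_representative[OF W] by blast
  moreover have "continuous_on \<Omega> (\<lambda>x. norm (W x))"
    by (intro continuous_intros) simp
  ultimately obtain x where x: "x \<in> \<Omega>" "\<forall>y\<in>\<Omega>. norm (W y) \<le> norm (W x)"
    using continuous_attains_sup by blast
  have "norm (W y) \<le> norm (W x)" for y
    using periodic_matfun_representative[OF W, of y] x(2) by metis
  then have "norm W \<le> norm (W x)"
    by (rule norm_bound)
  moreover have "norm (W y) \<le> norm W" for y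
    by (rule norm_bounded)
  ultimately show ?thesis
    using x(1) by (meson order_antisym)
qed

section \<open>The Laplacian\<close>

definition line_at :: "(real ^ 'm \<Rightarrow> 'b::real_normed_vector) \<Rightarrow> 'm \<Rightarrow> real ^ 'm \<Rightarrow> real \<Rightarrow> 'b" where
  "line_at g i x = (\<lambda>t. g (x + t *\<^sub>R axis i 1))"

definition partial_deriv ::
    "'m::finite \<Rightarrow> (real ^ 'm \<Rightarrow> 'b::real_normed_vector) \<Rightarrow> real ^ 'm \<Rightarrow> 'b" where
  "partial_deriv i g x = vector_derivative (line_at g i x) (at 0)"

definition C1_fun :: "(real ^ 'm::finite \<Rightarrow> 'b::real_normed_vector) \<Rightarrow> bool" where
  "C1_fun g \<longleftrightarrow>
    (\<forall>i. (\<forall>x. line_at g i x differentiable (at 0)) \<and> continuous_on UNIV (partial_deriv i g))"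

definition C2_fun :: "(real ^ 'm::finite \<Rightarrow> 'b::real_normed_vector) \<Rightarrow> bool" where
  "C2_fun g \<longleftrightarrow> C1_fun g \<and> (\<forall>i. C1_fun (partial_deriv i g))"

definition laplacian :: "(real ^ 'm::finite \<Rightarrow> 'b::real_normed_vector) \<Rightarrow> real ^ 'm \<Rightarrow> 'b" where
  "laplacian g x = (\<Sum>i\<in>UNIV. partial_deriv i (partial_deriv i g) x)"

section \<open>The periodic heat semigroup\<close>

text \<open>
  Operators on the subspace \<open>X\<close> are functions on the ambient type, of which only the values on \<open>X\<close>
  matter; only times \<open>t \<ge> 0\<close> matter.
\<close>

definition C0_semigroup_on ::
    "'a::real_normed_vector set \<Rightarrow> (real \<Rightarrow> 'a \<Rightarrow> 'a) \<Rightarrow> bool" where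
  "C0_semigroup_on X S \<longleftrightarrow>
    (\<forall>t\<ge>0. S t ` X \<subseteq> X
      \<and> (\<forall>v\<in>X. \<forall>w\<in>X. S t (v + w) = S t v + S t w)
      \<and> (\<forall>c. \<forall>w\<in>X. S t (c *\<^sub>R w) = c *\<^sub>R S t w)
      \<and> (\<exists>K. \<forall>w\<in>X. norm (S t w) \<le> K * norm w))
    \<and> (\<forall>w\<in>X. S 0 w = w)
    \<and> (\<forall>s\<ge>0. \<forall>t\<ge>0. \<forall>w\<in>X. S (s + t) w = S s (S t w))
    \<and> (\<forall>w\<in>X. ((\<lambda>t. S t w) \<longlongrightarrow> w) (at_right 0))"

text \<open>The infinitesimal generator, as the graph of an operator with domain in \<open>X\<close>.\<close>

definition generator_graph ::
    "'a::real_normed_vector set \<Rightarrow> (real \<Rightarrow> 'a \<Rightarrow> 'a) \<Rightarrow> ('a \<times> 'a) set" where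
  "generator_graph X S =
    {(w, v). w \<in> X \<and> v \<in> X \<and> ((\<lambda>h. (S h w - w) /\<^sub>R h) \<longlongrightarrow> v) (at_right 0)}"

definition heat_graph :: "real \<Rightarrow> ('m::finite matfun \<times> 'm matfun) set" where
  "heat_graph \<epsilon> =
    {(W, V). W \<in> periodic_matfun \<and> V \<in> periodic_matfun \<and> C2_fun W
      \<and> (\<forall>x. V x = \<epsilon>\<^sup>2 *\<^sub>R laplacian W x)}"

text \<open>
  \<open>S t = e\<^sup>t\<^sup>L\<close> with \<open>L = \<epsilon>\<^sup>2 \<Delta>\<close>.  For more than one space dimension, \<open>\<epsilon>\<^sup>2 \<Delta>\<close> on the twice continuously
  differentiable periodic functions is not closed in the maximum norm, and the operator \<open>L\<close> that
  generates the heat semigroup is its closure.  This determines \<open>S t\<close> on the periodic functions for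
  all \<open>t \<ge> 0\<close>.
\<close>

definition is_heat_semigroup :: "real \<Rightarrow> (real \<Rightarrow> 'm::finite matfun \<Rightarrow> 'm matfun) \<Rightarrow> bool" where
  "is_heat_semigroup \<epsilon> S \<longleftrightarrow>
    C0_semigroup_on periodic_matfun S
    \<and> generator_graph periodic_matfun S = closure (heat_graph \<epsilon>)"

section \<open>The ETD1 scheme\<close>

definition f_AC :: "real ^ 'm ^ 'm \<Rightarrow> real ^ 'm ^ 'm" where
  "f_AC A = A - A ** transpose A ** A"

definition nonlin :: "real \<Rightarrow> 'm::finite matfun \<Rightarrow> 'm matfun" where
  "nonlin \<kappa> U = Bcontfun (\<lambda>x. \<kappa> *\<^sub>R U x + f_AC (U x))"

lemma nonlin_apply [simp]:
  fixes U :: "'m::finite matfun"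
  shows "nonlin \<kappa> U x = \<kappa> *\<^sub>R U x + f_AC (U x)"
proof -
  define F where "F = (\<lambda>A :: real ^ 'm ^ 'm. \<kappa> *\<^sub>R A + f_AC A)"
  have F: "continuous_on T F" for T
    unfolding F_def f_AC_def matrix_matrix_mult_def transpose_def
    by (intro continuous_intros)
  have "compact (F ` closure (range U))"
    by (intro compact_continuous_image F) simp
  then have "bounded (F ` range U)"
    by (meson bounded_subset closure_subset compact_imp_bounded image_mono)
  moreover have "continuous_on UNIV (F \<circ> apply_bcontfun U)"
    by (intro continuous_on_compose F) simp
  ultimately have "(\<lambda>x. F (U x)) \<in> bcontfun"
    by (simp add: bcontfun_def o_def image_image)
  then show ?thesis
    by (simp add: nonlin_def F_def Bcontfun_inverse)
qed

text \<open>\<open>e\<^sup>(\<^sup>L\<^sup>-\<^sup>\<kappa>\<^sup>)\<^sup>t\<close>\<close>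

definition damped :: "real \<Rightarrow> (real \<Rightarrow> 'm::finite matfun \<Rightarrow> 'm matfun) \<Rightarrow> real \<Rightarrow> 'm matfun \<Rightarrow> 'm matfun"
  where "damped \<kappa> S t W = exp (- \<kappa> * t) *\<^sub>R S t W"

primrec ETD1 ::
    "(real \<Rightarrow> 'm::finite matfun \<Rightarrow> 'm matfun) \<Rightarrow> real \<Rightarrow> real \<Rightarrow> 'm matfun \<Rightarrow> nat \<Rightarrow> 'm matfun" where
  "ETD1 S \<kappa> \<tau> U0 0 = U0"
| "ETD1 S \<kappa> \<tau> U0 (Suc n) =
    damped \<kappa> S \<tau> (ETD1 S \<kappa> \<tau> U0 n)
    + integral {0..\<tau>} (\<lambda>s. damped \<kappa> S (\<tau> - s) (nonlin \<kappa> (ETD1 S \<kappa> \<tau> U0 n)))"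

end

theory Submission
  imports Defs
begin

text \<open>
  One step of the scheme splits into \<open>e\<^sup>-\<^sup>\<kappa>\<^sup>\<tau> e\<^sup>\<tau>\<^sup>L U\<close> and an integral of
  \<open>e\<^sup>-\<^sup>\<kappa>\<^sup>(\<^sup>\<tau>\<^sup>-\<^sup>s\<^sup>) e\<^sup>(\<^sup>\<tau>\<^sup>-\<^sup>s\<^sup>)\<^sup>L N[U]\<close> over \<open>0 \<le> s \<le> \<tau>\<close>.  If the heat semigroup is a contraction in the maximum norm and \<open>|N[U]| \<le> \<kappa> \<surd>m\<close> whenever \<open>|U| \<le> \<surd>m\<close>, then the norm of the new value is
  at most \<open>e\<^sup>-\<^sup>\<kappa>\<^sup>\<tau> \<surd>m + (1 - e\<^sup>-\<^sup>\<kappa>\<^sup>\<tau>) \<surd>m = \<surd>m\<close> (\<open>ETD1_step_bound\<close>), without any restriction on \<open>\<tau>\<close>.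

  The bound on the nonlinearity is a pointwise statement about a single matrix
  (\<open>norm_stabilized_f_AC_le\<close>), obtained by expanding a square in the Frobenius inner product.

  The contraction property has to be derived from the description of the semigroup by its
  generator, the closure of \<open>\<epsilon>\<^sup>2 \<Delta>\<close>.  A vector-valued maximum principle shows that the Laplacian, and
  hence its closure, is dissipative (\<open>closure_heat_graph_dissipative\<close>): \<open>|W| \<le> |W - h L W|\<close> for
  \<open>h \<ge> 0\<close>.  For the generator of a strongly continuous semigroup, dissipativity makes the norm
  nonincreasing along orbits that start in the domain of the generator (\<open>contraction_on_domain\<close>),
  and these orbits suffice because the domain is dense (\<open>generator_domain_dense\<close>).  Both steps use
  that orbits are continuous in time (\<open>continuous_orbit\<close>), which rests on the uniform boundedness
  principle (\<open>bounded_near_zero\<close>).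
\<close>

section \<open>The stabilized nonlinearity\<close>

lemma inner_matrix_mult_right:
  fixes X :: "real ^ 'p ^ 'm" and Y :: "real ^ 'n ^ 'm" and Z :: "real ^ 'p ^ 'n"
  shows "X \<bullet> (Y ** Z) = (transpose Y ** X) \<bullet> Z"
proof -
  have "X \<bullet> (Y ** Z) = (\<Sum>i\<in>UNIV. \<Sum>j\<in>UNIV. \<Sum>k\<in>UNIV. X $ i $ j * (Y $ i $ k * Z $ k $ j))"
    by (simp add: inner_vec_def matrix_matrix_mult_def sum_distrib_left)
  also have "\<dots> = (\<Sum>i\<in>UNIV. \<Sum>k\<in>UNIV. \<Sum>j\<in>UNIV. X $ i $ j * (Y $ i $ k * Z $ k $ j))"
    by (rule sum.cong[OF refl], rule sum.swap)
  also have "\<dots> = (\<Sum>k\<in>UNIV. \<Sum>i\<in>UNIV. \<Sum>j\<in>UNIV. X $ i $ j * (Y $ i $ k * Z $ k $ j))"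
    by (rule sum.swap)
  also have "\<dots> = (\<Sum>k\<in>UNIV. \<Sum>j\<in>UNIV. \<Sum>i\<in>UNIV. X $ i $ j * (Y $ i $ k * Z $ k $ j))"
    by (rule sum.cong[OF refl], rule sum.swap)
  also have "\<dots> = (\<Sum>k\<in>UNIV. \<Sum>j\<in>UNIV. (\<Sum>i\<in>UNIV. Y $ i $ k * X $ i $ j) * Z $ k $ j)"
    unfolding sum_distrib_right by (simp add: mult_ac)
  also have "\<dots> = (transpose Y ** X) \<bullet> Z"
    by (simp add: inner_vec_def matrix_matrix_mult_def transpose_def)
  finally show ?thesis .
qed

lemma norm_power2_matrix:
  fixes A :: "real ^ 'n ^ 'm"
  shows "(norm A)\<^sup>2 = (\<Sum>i\<in>UNIV. (norm (A $ i))\<^sup>2)"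
  by (simp add: power2_norm_eq_inner inner_vec_def)

lemma norm_transpose:
  fixes A :: "real ^ 'n ^ 'm"
  shows "norm (transpose A) = norm A"
  unfolding norm_matrix_eq_frobenius transpose_def
  by (subst sum.swap) simp

lemma norm_matrix_mult_le:
  fixes A :: "real ^ 'n ^ 'm" and B :: "real ^ 'p ^ 'n"
  shows "norm (A ** B) \<le> norm A * norm B"
proof -
  have entry: "((A ** B) $ i $ j)\<^sup>2 \<le> (norm (A $ i))\<^sup>2 * (norm (transpose B $ j))\<^sup>2" for i j
  proof -
    have "(A ** B) $ i $ j = (A $ i) \<bullet> (transpose B $ j)"
      by (simp add: matrix_matrix_mult_def transpose_def inner_vec_def)
    then show ?thesis
      using Cauchy_Schwarz_ineq[of "A $ i" "transpose B $ j"] by (simp add: power2_norm_eq_inner)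
  qed
  have "(norm (A ** B))\<^sup>2 = (\<Sum>i\<in>UNIV. \<Sum>j\<in>UNIV. ((A ** B) $ i $ j)\<^sup>2)"
    by (simp add: norm_matrix_eq_frobenius sum_nonneg)
  also have "\<dots> \<le> (\<Sum>i\<in>UNIV. \<Sum>j\<in>UNIV. (norm (A $ i))\<^sup>2 * (norm (transpose B $ j))\<^sup>2)"
    by (intro sum_mono entry)
  also have "\<dots> = (norm A)\<^sup>2 * (norm (transpose B))\<^sup>2"
    by (simp add: norm_power2_matrix sum_product)
  also have "\<dots> = (norm A * norm B)\<^sup>2"
    by (simp add: norm_transpose power_mult_distrib)
  finally show ?thesis
    by (rule power2_le_imp_le) simp
qed

text \<open>
  With \<open>B = A\<^sup>T A - 1\<close> the stabilized nonlinearity is \<open>\<kappa> A - A B\<close>.  Expanding its squared norm, the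
  quadratic term is at most \<open>m |B|\<^sup>2\<close>, while the cross term contributes
  \<open>- 2 \<kappa> (|B|\<^sup>2 + |A|\<^sup>2 - m)\<close> because \<open>\<langle>A, A B\<rangle> = \<langle>A\<^sup>T A, B\<rangle> = \<langle>B + 1, B\<rangle>\<close>.  The \<open>|B|\<^sup>2\<close> terms have a
  nonpositive sum if \<open>m \<le> 2 \<kappa>\<close>, and \<open>\<kappa>\<^sup>2 |A|\<^sup>2 - 2 \<kappa> (|A|\<^sup>2 - m)\<close> is nondecreasing in \<open>|A|\<^sup>2\<close> if
  \<open>\<kappa> \<ge> 2\<close>, with value \<open>\<kappa>\<^sup>2 m\<close> at \<open>|A|\<^sup>2 = m\<close>.
\<close>

lemma norm_stabilized_f_AC_le:
  fixes A :: "real ^ 'm ^ 'm"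
  assumes A: "norm A \<le> sqrt (real CARD('m))"
    and \<kappa>: "2 \<le> \<kappa>" "real CARD('m) \<le> 2 * \<kappa>"
  shows "norm (\<kappa> *\<^sub>R A + f_AC A) \<le> \<kappa> * sqrt (real CARD('m))"
proof -
  define m where "m = real CARD('m)"
  define I where "I = (mat 1 :: real ^ 'm ^ 'm)"
  define B where "B = transpose A ** A - I"
  define p where "p = (norm A)\<^sup>2"
  have "(norm A)\<^sup>2 \<le> (sqrt m)\<^sup>2"
    using A by (intro power_mono) (simp_all add: m_def)
  then have p: "p \<le> m"
    by (simp add: p_def m_def)
  have AB: "A ** B = A ** transpose A ** A - A"
    using matrix_add_ldistrib[of A B I] by (simp add: B_def I_def matrix_mul_assoc)
  have form: "\<kappa> *\<^sub>R A + f_AC A = \<kappa> *\<^sub>R A - A ** B"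
    by (simp add: f_AC_def AB)
  have "I \<bullet> I = m"
    by (simp add: I_def m_def mat_def inner_vec_def if_distrib cong: if_cong)
  moreover have "I \<bullet> (transpose A ** A) = p"
    using inner_matrix_mult_right[of A A I]
    by (simp add: p_def I_def power2_norm_eq_inner inner_commute)
  ultimately have trace: "I \<bullet> B = p - m"
    by (simp add: B_def inner_diff_right)
  have "A \<bullet> (A ** B) = (transpose A ** A) \<bullet> B"
    by (rule inner_matrix_mult_right)
  also have "\<dots> = (B + I) \<bullet> B"
    by (simp add: B_def)
  also have "\<dots> = (norm B)\<^sup>2 + (p - m)"
    by (simp only: inner_add_left trace power2_norm_eq_inner)
  finally have cross: "A \<bullet> (A ** B) = (norm B)\<^sup>2 + (p - m)" .
  have "(norm (A ** B))\<^sup>2 \<le> (norm A * norm B)\<^sup>2"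
    by (intro power_mono norm_matrix_mult_le) simp
  also have "\<dots> \<le> 2 * \<kappa> * (norm B)\<^sup>2"
    unfolding power_mult_distrib using p \<kappa> by (intro mult_right_mono) (simp_all add: p_def m_def)
  finally have quad: "(norm (A ** B))\<^sup>2 \<le> 2 * \<kappa> * (norm B)\<^sup>2" .
  have "(norm (\<kappa> *\<^sub>R A - A ** B))\<^sup>2
      = \<kappa>\<^sup>2 * p - 2 * \<kappa> * (A \<bullet> (A ** B)) + (norm (A ** B))\<^sup>2"
    unfolding p_def power2_norm_eq_inner
    by (simp add: inner_diff_left inner_diff_right inner_commute power2_eq_square algebra_simps)
  also have "\<dots> \<le> \<kappa>\<^sup>2 * m + \<kappa> * (\<kappa> - 2) * (p - m)"
    using quad by (simp add: cross power2_eq_square algebra_simps)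
  also have "\<dots> \<le> \<kappa>\<^sup>2 * m"
    using p \<kappa> by (simp add: mult_nonneg_nonpos)
  also have "\<dots> = (\<kappa> * sqrt m)\<^sup>2"
    by (simp add: power_mult_distrib m_def)
  finally have "norm (\<kappa> *\<^sub>R A - A ** B) \<le> \<kappa> * sqrt m"
    by (rule power2_le_imp_le) (use \<kappa> in \<open>simp add: m_def\<close>)
  then show ?thesis
    by (simp add: form m_def)
qed

section \<open>Dissipativity of the Laplacian\<close>

lemma second_derivative_at_max_nonpos:
  fixes g g' :: "real \<Rightarrow> real"
  assumes g: "\<And>t. (g has_real_derivative g' t) (at t)"
    and d: "(g' has_real_derivative d) (at 0)"
    and max: "\<And>t. g t \<le> g 0"
  shows "d \<le> 0"
proof (rule ccontr)
  assume "\<not> d \<le> 0"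
  then have "0 < d" by simp
  have g0: "g' 0 = 0"
    using DERIV_local_max[OF g, of 1 0] max by simp
  obtain \<delta> where "\<delta> > 0" and inc: "\<And>h. 0 < h \<Longrightarrow> h < \<delta> \<Longrightarrow> g' 0 < g' (0 + h)"
    using DERIV_pos_inc_right[OF d \<open>0 < d\<close>] by blast
  have "\<exists>z>0. z < \<delta> / 2 \<and> g (\<delta> / 2) - g 0 = (\<delta> / 2 - 0) * g' z"
    using \<open>\<delta> > 0\<close> by (intro MVT2 g) simp
  then obtain z where z: "0 < z" "z < \<delta> / 2" "g (\<delta> / 2) - g 0 = \<delta> / 2 * g' z"
    by auto
  have "0 < \<delta> / 2 * g' z"
    using inc[of z] z g0 \<open>\<delta> > 0\<close> by simp
  then show False
    using z(3) max[of "\<delta> / 2"] by simp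
qed

text \<open>
  Differentiability along a coordinate line is defined at parameter \<open>0\<close> for every base point; moving
  the base point along the line gives it at every parameter.
\<close>

lemma C1_fun_line_derivative:
  assumes "C1_fun g"
  shows "(line_at g i x has_vector_derivative partial_deriv i g (x + t *\<^sub>R axis i 1)) (at t)"
proof -
  define y where "y = x + t *\<^sub>R axis i 1"
  have "line_at g i y differentiable (at 0)"
    using assms by (auto simp: C1_fun_def)
  then have "(line_at g i y has_vector_derivative partial_deriv i g y) (at 0)"
    by (simp add: partial_deriv_def vector_derivative_works)
  then have "((\<lambda>s. line_at g i y (s - t)) has_vector_derivative 1 *\<^sub>R partial_deriv i g y) (at t)"
    by (intro vector_diff_chain_at[of "\<lambda>s. s - t" 1 t "line_at g i y", unfolded o_def])
      (auto intro!: derivative_eq_intros)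
  moreover have "(\<lambda>s. line_at g i y (s - t)) = line_at g i x"
    by (simp add: line_at_def y_def fun_eq_iff algebra_simps)
  ultimately show ?thesis
    by (simp add: y_def)
qed

text \<open>
  Maximum principle for vector-valued functions.  The scalar function \<open>y \<mapsto> g y \<bullet> g x\<close> also has its
  maximum at \<open>x\<close>, by the Cauchy-Schwarz inequality, and so each of its pure second derivatives
  there is nonpositive.  Projecting onto the fixed vector \<open>g x\<close> avoids differentiating the norm.
\<close>

lemma laplacian_inner_at_max_nonpos:
  fixes g :: "real ^ 'm::finite \<Rightarrow> 'b::real_inner"
  assumes g: "C2_fun g" and max: "\<And>y. norm (g y) \<le> norm (g x)"
  shows "laplacian g x \<bullet> g x \<le> 0"
proof -
  have "partial_deriv i (partial_deriv i g) x \<bullet> g x \<le> 0" for i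
  proof -
    have inner: "((\<lambda>t. line_at h i x t \<bullet> g x) has_real_derivative
        partial_deriv i h (x + t *\<^sub>R axis i 1) \<bullet> g x) (at t)" if "C1_fun h" for h t
      using bounded_linear.has_vector_derivative[OF bounded_linear_inner_left C1_fun_line_derivative[OF that]]
      by (simp add: has_real_derivative_iff_has_vector_derivative)
    have "C1_fun g" "C1_fun (partial_deriv i g)"
      using g by (auto simp: C2_fun_def)
    show ?thesis
    proof (rule second_derivative_at_max_nonpos)
      show "((\<lambda>t. line_at g i x t \<bullet> g x) has_real_derivative line_at (partial_deriv i g) i x t \<bullet> g x) (at t)" for t
        using inner[OF \<open>C1_fun g\<close>] by (simp add: line_at_def)
      show "((\<lambda>t. line_at (partial_deriv i g) i x t \<bullet> g x) has_real_derivative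
          partial_deriv i (partial_deriv i g) x \<bullet> g x) (at 0)"
        using inner[OF \<open>C1_fun (partial_deriv i g)\<close>, of 0] by simp
      fix t
      have "line_at g i x t \<bullet> g x \<le> norm (line_at g i x t) * norm (g x)"
        by (rule norm_cauchy_schwarz)
      also have "\<dots> \<le> norm (g x) * norm (g x)"
        using max by (intro mult_right_mono) (auto simp: line_at_def)
      also have "\<dots> = line_at g i x 0 \<bullet> g x"
        by (simp add: line_at_def norm_eq_sqrt_inner)
      finally show "line_at g i x t \<bullet> g x \<le> line_at g i x 0 \<bullet> g x" .
    qed
  qed
  then show ?thesis
    by (simp add: laplacian_def inner_sum_left sum_nonpos)
qed

text \<open>
  Test \<open>W - h V\<close> against \<open>W x\<close>, where \<open>x\<close> is a point at which \<open>|W|\<close> is maximal.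
\<close>

lemma heat_graph_dissipative:
  fixes W V :: "'m::finite matfun"
  assumes WV: "(W, V) \<in> heat_graph \<epsilon>" and "h \<ge> 0"
  shows "norm W \<le> norm (W - h *\<^sub>R V)"
proof (cases "W = 0")
  case False
  have W: "W \<in> periodic_matfun" "C2_fun W" and V: "\<And>x. V x = \<epsilon>\<^sup>2 *\<^sub>R laplacian W x"
    using WV by (auto simp: heat_graph_def)
  obtain x where x: "norm (W x) = norm W"
    using norm_periodic_matfun[OF W(1)] by blast
  have "laplacian W x \<bullet> W x \<le> 0"
    using W(2) by (rule laplacian_inner_at_max_nonpos) (simp add: x norm_bounded)
  then have "h * (V x \<bullet> W x) \<le> 0"
    using \<open>h \<ge> 0\<close> by (simp add: V mult_nonneg_nonpos)
  then have "W x \<bullet> W x \<le> (W x - h *\<^sub>R V x) \<bullet> W x"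
    by (simp add: inner_diff_left)
  also have "\<dots> \<le> norm ((W - h *\<^sub>R V) x) * norm (W x)"
    by (simp add: norm_cauchy_schwarz)
  also have "\<dots> \<le> norm (W - h *\<^sub>R V) * norm (W x)"
    by (intro mult_right_mono norm_bounded) simp
  finally have "norm W * norm W \<le> norm (W - h *\<^sub>R V) * norm W"
    using x by (simp add: dot_square_norm power2_eq_square)
  then show ?thesis
    using False by simp
qed simp

text \<open>
  For fixed \<open>h\<close> the estimate is a closed condition on the pair \<open>(W, V)\<close>, and so it passes from
  the Laplacian on twice continuously differentiable functions to the generator.
\<close>

lemma closure_heat_graph_dissipative:
  fixes W V :: "'m::finite matfun"
  assumes "(W, V) \<in> closure (heat_graph \<epsilon>)" and "h \<ge> 0"
  shows "norm W \<le> norm (W - h *\<^sub>R V)"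
proof -
  define D where "D = {p :: 'm matfun \<times> 'm matfun. norm (fst p) \<le> norm (fst p - h *\<^sub>R snd p)}"
  have "closed D"
    unfolding D_def by (intro closed_Collect_le continuous_intros)
  moreover have "heat_graph \<epsilon> \<subseteq> D"
    using heat_graph_dissipative[OF _ \<open>h \<ge> 0\<close>] by (auto simp: D_def)
  ultimately have "closure (heat_graph \<epsilon>) \<subseteq> D"
    by (rule closure_minimal[rotated])
  then show ?thesis
    using assms(1) by (auto simp: D_def)
qed

section \<open>Integrals in a closed subspace\<close>

text \<open>
  Riemann sums lie in the subspace and approximate the integral.
\<close>

lemma has_integral_mem_closed_subspace:
  fixes f :: "real \<Rightarrow> 'a::real_normed_vector"
  assumes X: "subspace X" "closed X"
    and f: "\<And>t. t \<in> {a..b} \<Longrightarrow> f t \<in> X"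
    and int: "(f has_integral y) {a..b}"
  shows "y \<in> X"
proof -
  have "\<exists>x\<in>X. dist x y < e" if "e > 0" for e
  proof -
    obtain \<gamma> where "gauge \<gamma>" and \<gamma>: "\<And>\<D>. \<D> tagged_division_of {a..b} \<Longrightarrow> \<gamma> fine \<D> \<Longrightarrow>
        norm ((\<Sum>(x, k)\<in>\<D>. measure lborel k *\<^sub>R f x) - y) < e"
      using int \<open>e > 0\<close> unfolding has_integral_real by metis
    obtain \<D> where \<D>: "\<D> tagged_division_of {a..b}" "\<gamma> fine \<D>"
      using fine_division_exists_real[OF \<open>gauge \<gamma>\<close>] by metis
    have "f x \<in> X" if "(x, k) \<in> \<D>" for x k
      using f tagged_division_ofD(2,3)[OF \<D>(1)] that by blast
    then have "(\<Sum>(x, k)\<in>\<D>. measure lborel k *\<^sub>R f x) \<in> X"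
      by (intro subspace_sum[OF X(1)]) (auto intro!: subspace_scale[OF X(1)])
    then show ?thesis
      using \<gamma>[OF \<D>] by (auto simp: dist_norm)
  qed
  then have "y \<in> closure X"
    by (simp add: closure_approachable)
  then show ?thesis
    using X(2) by (simp add: closure_closed)
qed

text \<open>
  A semigroup operator is linear only on the subspace \<open>X\<close>, and need not extend to a bounded linear
  operator on the ambient space.  Hence the interchange of operator and integral is proved directly
  on Riemann sums, all of which lie in \<open>X\<close>.
\<close>

lemma has_integral_linear_on_subspace:
  fixes f :: "real \<Rightarrow> 'a::real_normed_vector" and T :: "'a \<Rightarrow> 'b::real_normed_vector"
  assumes X: "subspace X" "closed X"
    and add: "\<And>v w. v \<in> X \<Longrightarrow> w \<in> X \<Longrightarrow> T (v + w) = T v + T w"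
    and scale: "\<And>c w. w \<in> X \<Longrightarrow> T (c *\<^sub>R w) = c *\<^sub>R T w"
    and bound: "\<And>w. w \<in> X \<Longrightarrow> norm (T w) \<le> K * norm w"
    and f: "\<And>t. t \<in> {a..b} \<Longrightarrow> f t \<in> X"
    and int: "(f has_integral y) {a..b}"
  shows "((\<lambda>t. T (f t)) has_integral T y) {a..b}"
proof -
  have y: "y \<in> X"
    using has_integral_mem_closed_subspace[OF X f int] .
  have T0: "T 0 = 0"
    using scale[of 0 0] subspace_0[OF X(1)] by simp
  have diff: "T (v - w) = T v - T w" if "v \<in> X" "w \<in> X" for v w
    using add[of v "- w"] scale[of w "- 1"] that subspace_neg[OF X(1)] by simp
  have T_sum: "(\<Sum>i\<in>I. g i) \<in> X \<and> T (\<Sum>i\<in>I. g i) = (\<Sum>i\<in>I. T (g i))"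
    if "finite I" "\<And>i. i \<in> I \<Longrightarrow> g i \<in> X" for I :: "(real \<times> real set) set" and g
    using that by (induction I) (auto simp: T0 add subspace_0[OF X(1)] subspace_add[OF X(1)])
  show ?thesis
    unfolding has_integral_real
  proof (intro allI impI)
    fix e :: real
    assume "e > 0"
    then have "e / (\<bar>K\<bar> + 1) > 0" by simp
    then obtain \<gamma> where "gauge \<gamma>" and \<gamma>: "\<And>\<D>. \<D> tagged_division_of {a..b} \<Longrightarrow> \<gamma> fine \<D> \<Longrightarrow>
        norm ((\<Sum>(x, k)\<in>\<D>. measure lborel k *\<^sub>R f x) - y) < e / (\<bar>K\<bar> + 1)"
      using int unfolding has_integral_real by metis
    have "norm ((\<Sum>(x, k)\<in>\<D>. measure lborel k *\<^sub>R T (f x)) - T y) < e"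
      if \<D>: "\<D> tagged_division_of {a..b}" "\<gamma> fine \<D>" for \<D>
    proof -
      define r where "r = (\<Sum>(x, k)\<in>\<D>. measure lborel k *\<^sub>R f x)"
      have fX: "f x \<in> X" if "(x, k) \<in> \<D>" for x k
        using f tagged_division_ofD(2,3)[OF \<D>(1)] that by blast
      have "r \<in> X \<and> T r = (\<Sum>p\<in>\<D>. T (case p of (x, k) \<Rightarrow> measure lborel k *\<^sub>R f x))"
        unfolding r_def using tagged_division_ofD(1)[OF \<D>(1)]
        by (intro T_sum) (auto intro!: subspace_scale[OF X(1)] fX)
      moreover have "(\<Sum>p\<in>\<D>. T (case p of (x, k) \<Rightarrow> measure lborel k *\<^sub>R f x))
          = (\<Sum>(x, k)\<in>\<D>. measure lborel k *\<^sub>R T (f x))"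
        by (intro sum.cong) (auto simp: scale fX)
      ultimately have r: "r \<in> X" "(\<Sum>(x, k)\<in>\<D>. measure lborel k *\<^sub>R T (f x)) = T r"
        by auto
      have "norm (T r - T y) = norm (T (r - y))"
        by (simp add: diff r y)
      also have "\<dots> \<le> K * norm (r - y)"
        using r y by (intro bound subspace_diff[OF X(1)])
      also have "\<dots> \<le> (\<bar>K\<bar> + 1) * norm (r - y)"
        by (intro mult_right_mono) auto
      also have "\<dots> < (\<bar>K\<bar> + 1) * (e / (\<bar>K\<bar> + 1))"
        using \<gamma>[OF \<D>] by (intro mult_strict_left_mono) (auto simp: r_def)
      also have "\<dots> = e"
        by simp
      finally show ?thesis
        by (simp add: r)
    qed
    then show "\<exists>\<gamma>. gauge \<gamma> \<and> (\<forall>\<D>. \<D> tagged_division_of {a..b} \<and> \<gamma> fine \<D> \<longrightarrow>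
        norm ((\<Sum>(x, k)\<in>\<D>. measure lborel k *\<^sub>R T (f x)) - T y) < e)"
      using \<open>gauge \<gamma>\<close> by blast
  qed
qed

section \<open>Contraction semigroups\<close>

text \<open>
  The usual argument with a right-sided upper derivative: the last time at which
  \<open>\<phi> t \<le> \<phi> 0 + e t\<close> cannot lie before \<open>T\<close>, since the inequality extends a little further to the right.
\<close>

lemma nonincreasing_if_upper_derivative_nonpos:
  fixes \<phi> :: "real \<Rightarrow> real"
  assumes cont: "continuous_on {0..} \<phi>"
    and dini: "\<And>t e. 0 \<le> t \<Longrightarrow> 0 < e \<Longrightarrow> eventually (\<lambda>h. \<phi> (t + h) \<le> \<phi> t + e * h) (at_right 0)"
    and "0 \<le> T"
  shows "\<phi> T \<le> \<phi> 0"
proof (rule field_le_epsilon)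
  fix e' :: real
  assume "e' > 0"
  \<comment> \<open>T + 1 instead of T covers T = 0.\<close>
  define e where "e = e' / (T + 1)"
  have e: "e > 0" "e * T \<le> e'"
    using \<open>e' > 0\<close> \<open>0 \<le> T\<close> by (auto simp: e_def field_simps)
  define A where "A = {t \<in> {0..T}. \<phi> t - e * t \<le> \<phi> 0}"
  have "closed A"
    unfolding A_def by (intro continuous_closed_preimage_constant continuous_on_closed_Collect_le
        continuous_intros continuous_on_subset[OF cont]) auto
  then have "compact A"
    by (auto simp: compact_eq_bounded_closed A_def intro: bounded_subset[OF bounded_closed_interval])
  moreover have "0 \<in> A"
    using \<open>0 \<le> T\<close> by (simp add: A_def)
  ultimately obtain s where s: "s \<in> A" "\<And>t. t \<in> A \<Longrightarrow> t \<le> s"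
    using compact_attains_sup[of A] by blast
  have "s = T"
  proof (rule ccontr)
    assume "s \<noteq> T"
    then have "0 \<le> s" "s < T"
      using s(1) by (auto simp: A_def)
    then have "eventually (\<lambda>h. h \<in> {0<..<T - s}) (at_right 0)"
      by (intro eventually_at_right_real) simp
    with dini[OF \<open>0 \<le> s\<close> e(1)]
    have "eventually (\<lambda>h. h > 0 \<and> h < T - s \<and> \<phi> (s + h) \<le> \<phi> s + e * h) (at_right 0)"
      by eventually_elim simp
    then obtain h where h: "0 < h" "h < T - s" "\<phi> (s + h) \<le> \<phi> s + e * h"
      using eventually_happens'[of "at_right (0::real)"] trivial_limit_at_right_real by blast
    then have "s + h \<in> A"
      using s(1) \<open>0 \<le> s\<close> by (auto simp: A_def algebra_simps)
    then show False
      using s(2) h(1) by force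
  qed
  then show "\<phi> T \<le> \<phi> 0 + e'"
    using s(1) e by (auto simp: A_def)
qed

text \<open>
  The operators are arbitrary outside \<open>X\<close>, so every statement is relative to this closed subspace.
\<close>

locale strongly_continuous_semigroup =
  fixes X :: "'a::banach set" and S :: "real \<Rightarrow> 'a \<Rightarrow> 'a"
  assumes subspace: "subspace X" and closed: "closed X" and semigroup: "C0_semigroup_on X S"
begin

lemma
  assumes "0 \<le> t"
  shows maps: "w \<in> X \<Longrightarrow> S t w \<in> X"
    and add: "v \<in> X \<Longrightarrow> w \<in> X \<Longrightarrow> S t (v + w) = S t v + S t w"
    and scale: "w \<in> X \<Longrightarrow> S t (c *\<^sub>R w) = c *\<^sub>R S t w"
  using semigroup[unfolded C0_semigroup_on_def, THEN conjunct1, THEN spec, THEN mp, OF assms]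
  by blast+

lemma bounded_operator:
  assumes "0 \<le> t"
  obtains K where "\<And>w. w \<in> X \<Longrightarrow> norm (S t w) \<le> K * norm w"
  using semigroup[unfolded C0_semigroup_on_def, THEN conjunct1, THEN spec, THEN mp, OF assms]
  by blast

lemma diff: "0 \<le> t \<Longrightarrow> v \<in> X \<Longrightarrow> w \<in> X \<Longrightarrow> S t (v - w) = S t v - S t w"
  using add[of t v "- w"] scale[of t w "- 1"] subspace_neg[OF subspace] by simp

lemma at_zero: "w \<in> X \<Longrightarrow> S 0 w = w"
  using semigroup by (auto simp: C0_semigroup_on_def)

lemma at_add: "0 \<le> s \<Longrightarrow> 0 \<le> t \<Longrightarrow> w \<in> X \<Longrightarrow> S (s + t) w = S s (S t w)"
  using semigroup by (auto simp: C0_semigroup_on_def)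

lemma tendsto_at_zero: "w \<in> X \<Longrightarrow> ((\<lambda>t. S t w) \<longlongrightarrow> w) (at_right 0)"
  using semigroup by (auto simp: C0_semigroup_on_def)

lemma tendsto_operator:
  assumes "0 \<le> t" and g: "(g \<longlongrightarrow> w) F" "eventually (\<lambda>x. g x \<in> X) F" and "w \<in> X"
  shows "((\<lambda>x. S t (g x)) \<longlongrightarrow> S t w) F"
proof -
  obtain K where K: "\<And>w. w \<in> X \<Longrightarrow> norm (S t w) \<le> K * norm w"
    using bounded_operator[OF \<open>0 \<le> t\<close>] by metis
  have "((\<lambda>x. S t (g x) - S t w) \<longlongrightarrow> 0) F"
  proof (rule Lim_null_comparison)
    show "\<forall>\<^sub>F x in F. norm (S t (g x) - S t w) \<le> K * norm (g x - w)"
      using g(2)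
    proof eventually_elim
      case (elim x)
      then show ?case
        using K[of "g x - w"] \<open>w \<in> X\<close> \<open>0 \<le> t\<close> by (simp add: diff subspace_diff[OF subspace])
    qed
    show "((\<lambda>x. K * norm (g x - w)) \<longlongrightarrow> 0) F"
      using g(1) by (auto intro!: tendsto_eq_intros simp: LIM_zero_iff)
  qed
  then show ?thesis
    by (simp add: LIM_zero_iff)
qed

text \<open>
  The definition bounds each operator separately and gives orbits that converge at time \<open>0\<close>.  The
  uniform bound near \<open>0\<close> is the uniform boundedness principle: the closed sets \<open>A n\<close> of vectors whose
  orbit has norm at most \<open>n\<close> up to time \<open>1 / (n + 1)\<close> cover \<open>X\<close>, so by the Baire category theorem one
  of them contains a ball of \<open>X\<close>, and linearity transports the bound on that ball to all of \<open>X\<close>.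
\<close>

lemma bounded_near_zero:
  obtains \<delta> M where "\<delta> > 0" "\<And>t w. t \<in> {0..\<delta>} \<Longrightarrow> w \<in> X \<Longrightarrow> norm (S t w) \<le> M * norm w"
proof -
  define A where "A n = {w \<in> X. \<forall>t\<in>{0..1 / (real n + 1)}. norm (S t w) \<le> real n}" for n :: nat
  have "closed (A n)" for n
    unfolding closed_sequential_limits
  proof (intro allI impI)
    fix x l
    assume "(\<forall>k. x k \<in> A n) \<and> x \<longlonglongrightarrow> l"
    then have x: "\<And>k. x k \<in> A n" "x \<longlonglongrightarrow> l" by auto
    have xX: "x k \<in> X" for k
      using x(1) by (auto simp: A_def)
    have l: "l \<in> X"
      using closed_sequentially[OF closed _ x(2)] xX by blast
    have "norm (S t l) \<le> real n" if t: "t \<in> {0..1 / (real n + 1)}" for t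
    proof (rule Lim_norm_ubound)
      show "(\<lambda>k. S t (x k)) \<longlonglongrightarrow> S t l"
        using t x(2) xX l by (intro tendsto_operator) auto
      show "\<forall>\<^sub>F k in sequentially. norm (S t (x k)) \<le> real n"
        using x(1) t by (auto simp: A_def)
    qed simp
    then show "l \<in> A n"
      using l by (simp add: A_def)
  qed
  then have A_closed: "closedin (top_of_set X) (A n)" for n
    by (intro closed_subset) (auto simp: A_def)
  have cover: "X \<subseteq> (\<Union>n. A n)"
  proof
    fix w
    assume "w \<in> X"
    have "eventually (\<lambda>t. norm (S t w) < norm w + 1) (at_right 0)"
      using tendsto_norm[OF tendsto_at_zero[OF \<open>w \<in> X\<close>]] by (rule order_tendstoD) simp
    then obtain b where "b > 0" and b: "\<And>t. 0 < t \<Longrightarrow> t < b \<Longrightarrow> norm (S t w) < norm w + 1"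
      unfolding eventually_at_right_field by auto
    obtain n :: nat where n: "real n \<ge> max (norm w + 1) (1 / b)"
      using real_arch_simple by blast
    have "1 / b < real n + 1"
      using n by simp
    then have "1 / (real n + 1) < b"
      using \<open>b > 0\<close> by (simp add: field_simps)
    then have "norm (S t w) \<le> real n" if "t \<in> {0..1 / (real n + 1)}" for t
      using b[of t] that n at_zero[OF \<open>w \<in> X\<close>] by (cases "t = 0") auto
    then have "w \<in> A n"
      using \<open>w \<in> X\<close> by (simp add: A_def)
    then show "w \<in> (\<Union>n. A n)"
      by blast
  qed
  have "\<exists>n. top_of_set X interior_of A n \<noteq> {}"
  proof (rule ccontr)
    assume "\<nexists>n. top_of_set X interior_of A n \<noteq> {}"
    moreover have "completely_metrizable_space (top_of_set X)"
      using closed by (intro completely_metrizable_space_closedin completely_metrizable_space_euclidean) simp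
    ultimately have "top_of_set X interior_of \<Union>(range A) = {}"
      using A_closed by (intro Baire_category_alt) auto
    moreover have "\<Union>(range A) = X"
      using cover by (auto simp: A_def)
    moreover have "top_of_set X interior_of X = X"
      using interior_of_topspace[of "top_of_set X"] by simp
    ultimately show False
      using subspace_0[OF subspace] by auto
  qed
  then obtain n w0 U where U: "openin (top_of_set X) U" "w0 \<in> U" "U \<subseteq> A n"
    by (auto simp: interior_of_def)
  then obtain r where "r > 0" and r: "ball w0 r \<inter> X \<subseteq> A n"
    unfolding openin_contains_ball by (meson subset_trans)
  have w0: "w0 \<in> A n" "w0 \<in> X"
    using U by (auto simp: A_def)
  have "norm (S t w) \<le> (4 * real n / r) * norm w"
    if t: "t \<in> {0..1 / (real n + 1)}" and w: "w \<in> X" for t w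
  proof (cases "w = 0")
    case True
    then show ?thesis
      using scale[of t 0 0] t subspace_0[OF subspace] by simp
  next
    case False
    \<comment> \<open>Scales w to length r / 2, so that w0 + c w stays in the ball; the difference of two orbits
      that are bounded by n then bounds the orbit of c w by 2 n.\<close>
    define c where "c = r / (2 * norm w)"
    have "c > 0"
      using \<open>r > 0\<close> False by (simp add: c_def)
    have cw: "c *\<^sub>R w \<in> X"
      using subspace_scale[OF subspace w] .
    have "norm (c *\<^sub>R w) = r / 2"
      using \<open>r > 0\<close> False by (simp add: c_def)
    then have "w0 + c *\<^sub>R w \<in> ball w0 r \<inter> X"
      using \<open>r > 0\<close> subspace_add[OF subspace w0(2) cw] by (simp add: dist_norm)
    then have "norm (S t (w0 + c *\<^sub>R w)) \<le> real n"
      using r t by (auto simp: A_def)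
    moreover have "norm (S t w0) \<le> real n"
      using w0 t by (auto simp: A_def)
    moreover have "c *\<^sub>R S t w = S t (w0 + c *\<^sub>R w) - S t w0"
      using t w w0 cw by (simp add: add scale)
    ultimately have "norm (c *\<^sub>R S t w) \<le> 2 * real n"
      using norm_triangle_ineq4[of "S t (w0 + c *\<^sub>R w)" "S t w0"] by simp
    then have "norm (S t w) \<le> 2 * real n / c"
      using \<open>c > 0\<close> by (simp add: field_simps)
    also have "\<dots> = (4 * real n / r) * norm w"
      using \<open>r > 0\<close> False by (simp add: c_def field_simps)
    finally show ?thesis .
  qed
  then show thesis
    by (intro that[of "1 / (real n + 1)" "4 * real n / r"]) auto
qed

lemma locally_bounded:
  obtains M where "M > 0" "\<And>t w. t \<in> {0..T} \<Longrightarrow> w \<in> X \<Longrightarrow> norm (S t w) \<le> M * norm w"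
proof -
  obtain \<delta> L where "\<delta> > 0" and L: "\<And>t w. t \<in> {0..\<delta>} \<Longrightarrow> w \<in> X \<Longrightarrow> norm (S t w) \<le> L * norm w"
    using bounded_near_zero by metis
  define M where "M = max 1 L"
  have "M \<ge> 1"
    by (simp add: M_def)
  have M: "norm (S t w) \<le> M * norm w" if "t \<in> {0..\<delta>}" "w \<in> X" for t w
  proof -
    have "L * norm w \<le> M * norm w"
      by (intro mult_right_mono) (auto simp: M_def)
    then show "norm (S t w) \<le> M * norm w"
      using L[OF that] by simp
  qed
  have steps: "norm (S t w) \<le> M ^ Suc n * norm w"
    if "t \<in> {0..real (Suc n) * \<delta>}" "w \<in> X" for n t w
    using that
  proof (induction n arbitrary: t w)
    case 0
    then show ?case using M by simp
  next
    case (Suc n)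
    show ?case
    proof (cases "t \<le> \<delta>")
      case True
      then have "norm (S t w) \<le> M * norm w"
        using Suc.prems by (intro M) auto
      also have "\<dots> \<le> M ^ Suc (Suc n) * norm w"
        using \<open>M \<ge> 1\<close> self_le_power[of M "Suc (Suc n)"] by (intro mult_right_mono) auto
      finally show ?thesis .
    next
      case False
      then have "S t w = S (t - \<delta>) (S \<delta> w)"
        using at_add[of "t - \<delta>" \<delta> w] Suc.prems \<open>\<delta> > 0\<close> by simp
      also have "norm \<dots> \<le> M ^ Suc n * norm (S \<delta> w)"
        using False Suc.prems \<open>\<delta> > 0\<close> by (intro Suc.IH maps) (auto simp: algebra_simps)
      also have "\<dots> \<le> M ^ Suc n * (M * norm w)"
        using \<open>M \<ge> 1\<close> Suc.prems \<open>\<delta> > 0\<close> by (intro mult_left_mono M) auto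
      finally show ?thesis
        by (simp add: mult_ac)
    qed
  qed
  obtain n :: nat where "T / \<delta> \<le> real n"
    using real_arch_simple by blast
  then have "T \<le> real (Suc n) * \<delta>"
    using \<open>\<delta> > 0\<close> by (simp add: field_simps)
  then show thesis
    using steps[of _ n] \<open>M \<ge> 1\<close> by (intro that[of "M ^ Suc n"]) auto
qed

text \<open>
  Right continuity at a fixed time only needs that time's operator to be bounded.  Left continuity compares
  \<open>S s w\<close> with \<open>S (s + h) w = S s (S h w)\<close> for a time \<open>s\<close> that varies, and this is where the
  operators have to be uniformly bounded on compact time intervals.
\<close>

lemma continuous_orbit:
  assumes "w \<in> X"
  shows "continuous_on {0..} (\<lambda>t. S t w)"
  unfolding continuous_on_iff
proof (intro ballI allI impI)
  fix t e :: real
  assume "t \<in> {0..}" "e > 0"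
  obtain M where "M > 0" and M: "\<And>s w. s \<in> {0..t + 1} \<Longrightarrow> w \<in> X \<Longrightarrow> norm (S s w) \<le> M * norm w"
    using locally_bounded[of "t + 1"] by metis
  have "eventually (\<lambda>h. dist (S h w) w < e / M) (at_right 0)"
    using tendsto_at_zero[OF \<open>w \<in> X\<close>] \<open>e > 0\<close> \<open>M > 0\<close> by (intro tendstoD) auto
  then obtain b where "b > 0" and b: "\<And>h. 0 < h \<Longrightarrow> h < b \<Longrightarrow> dist (S h w) w < e / M"
    unfolding eventually_at_right_field by auto
  have close: "dist (S (s + h) w) (S s w) < e" if "s \<in> {0..t + 1}" "0 < h" "h < b" for s h
  proof -
    have "S (s + h) w - S s w = S s (S h w - w)"
      using that \<open>w \<in> X\<close> by (simp add: at_add diff maps)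
    then have "dist (S (s + h) w) (S s w) \<le> M * dist (S h w) w"
      using M[of s "S h w - w"] that \<open>w \<in> X\<close> by (simp add: dist_norm subspace_diff[OF subspace] maps)
    also have "\<dots> < M * (e / M)"
      using b that \<open>M > 0\<close> by (intro mult_strict_left_mono) auto
    finally show ?thesis
      using \<open>M > 0\<close> by simp
  qed
  have "dist (S s w) (S t w) < e" if "s \<in> {0..}" "dist s t < min b 1" for s
  proof -
    consider "s = t" | "s < t" | "t < s" by linarith
    then show ?thesis
    proof cases
      case 2
      then show ?thesis
        using close[of s "t - s"] that by (simp add: dist_norm norm_minus_commute)
    next
      case 3
      then show ?thesis
        using close[of t "s - t"] that \<open>t \<in> {0..}\<close> by (simp add: dist_norm)
    qed (use \<open>e > 0\<close> in simp)
  qed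
  then show "\<exists>d>0. \<forall>s\<in>{0..}. dist s t < d \<longrightarrow> dist (S s w) (S t w) < e"
    using \<open>b > 0\<close> by (intro exI[of _ "min b 1"]) auto
qed

lemma generator_invariant:
  assumes "(w, v) \<in> generator_graph X S" "0 \<le> t"
  shows "(S t w, S t v) \<in> generator_graph X S"
proof -
  have w: "w \<in> X" and v: "v \<in> X" and lim: "((\<lambda>h. (S h w - w) /\<^sub>R h) \<longlongrightarrow> v) (at_right 0)"
    using assms by (auto simp: generator_graph_def)
  have pos: "eventually (\<lambda>h :: real. h > 0) (at_right 0)"
    by (rule eventually_at_right_less)
  have inX: "eventually (\<lambda>h. (S h w - w) /\<^sub>R h \<in> X) (at_right 0)"
    using pos by eventually_elim (auto intro!: subspace_scale[OF subspace] subspace_diff[OF subspace] maps w)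
  have "((\<lambda>h. S t ((S h w - w) /\<^sub>R h)) \<longlongrightarrow> S t v) (at_right 0)"
    by (rule tendsto_operator[OF \<open>0 \<le> t\<close> lim inX v])
  moreover have "eventually (\<lambda>h. S t ((S h w - w) /\<^sub>R h) = (S h (S t w) - S t w) /\<^sub>R h) (at_right 0)"
    using pos
  proof eventually_elim
    case (elim h)
    then have "S t (S h w) = S h (S t w)"
      using at_add[of t h w] at_add[of h t w] \<open>0 \<le> t\<close> w by (simp add: add.commute)
    then show ?case
      using elim \<open>0 \<le> t\<close> w by (simp add: scale diff maps subspace_diff[OF subspace])
  qed
  ultimately have "((\<lambda>h. (S h (S t w) - S t w) /\<^sub>R h) \<longlongrightarrow> S t v) (at_right 0)"
    by (simp add: tendsto_cong)
  then show ?thesis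
    using w v \<open>0 \<le> t\<close> by (simp add: generator_graph_def maps)
qed

text \<open>
  The averages \<open>1/h \<integral>\<^sub>0\<^sup>h S s w ds\<close> of the orbit converge to \<open>w\<close> and belong to the domain of the generator.
\<close>

lemma generator_domain_dense:
  assumes w: "w \<in> X"
  obtains y where "(y \<longlongrightarrow> w) (at_right (0::real))" "\<And>h. h > 0 \<Longrightarrow> \<exists>v. (y h, v) \<in> generator_graph X S"
proof -
  define F where "F t = integral {0..t} (\<lambda>s. S s w)" for t
  have cont: "continuous_on {a..b} (\<lambda>s. S s w)" if "0 \<le> a" for a b
    using continuous_orbit[OF w] by (rule continuous_on_subset) (use that in auto)
  have FX: "F t \<in> X" for t
    unfolding F_def
    by (rule has_integral_mem_closed_subspace[OF subspace closed _ integrable_integral])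
      (auto intro!: maps w integrable_continuous_real cont)
  have F_deriv: "((\<lambda>r. (F (t + r) - F t) /\<^sub>R r) \<longlongrightarrow> S t w) (at_right 0)" if "0 \<le> t" for t
  proof -
    have "(F has_vector_derivative S t w) (at t within {0..t + 1})"
      unfolding F_def using that by (intro integral_has_vector_derivative cont) auto
    then have "(F has_vector_derivative S t w) (at t within {t..t + 1})"
      by (rule has_vector_derivative_within_subset) (use that in auto)
    then have "((\<lambda>s. norm ((F s - F t) - (s - t) *\<^sub>R S t w) / norm (s - t)) \<longlongrightarrow> 0)
        (at t within {t..t + 1})"
      by (simp add: has_vector_derivative_def has_derivative_iff_norm)
    moreover have "at t within {t..t + 1} = at_right t"
      by (rule at_within_nhd[of _ "{t - 1<..<t + 1}"]) auto
    ultimately have "((\<lambda>r. norm ((F (t + r) - F t) - r *\<^sub>R S t w) / norm r) \<longlongrightarrow> 0) (at_right 0)"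
      by (simp add: filterlim_at_right_to_0[of _ _ t] add.commute)
    moreover have "eventually (\<lambda>r. norm ((F (t + r) - F t) - r *\<^sub>R S t w) / norm r
        = norm ((F (t + r) - F t) /\<^sub>R r - S t w)) (at_right 0)"
      using eventually_at_right_less[of 0]
    proof eventually_elim
      case (elim r)
      then have "(F (t + r) - F t) /\<^sub>R r - S t w = ((F (t + r) - F t) - r *\<^sub>R S t w) /\<^sub>R r"
        by (simp add: scaleR_diff_right)
      then show ?case
        using elim by (simp add: divide_inverse_commute)
    qed
    ultimately have "((\<lambda>r. norm ((F (t + r) - F t) /\<^sub>R r - S t w)) \<longlongrightarrow> 0) (at_right 0)"
      by (simp add: tendsto_cong)
    then show ?thesis
      by (simp add: tendsto_norm_zero_iff LIM_zero_iff)
  qed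
  have F0: "F 0 = 0"
    by (simp add: F_def)
  \<comment> \<open>The semigroup law turns S r into a translation of the interval of integration.  The difference
    quotient of F h is therefore one of F at h minus one of F at 0.\<close>
  have shift: "S r (F h) = F (h + r) - F r" if "0 \<le> r" "0 \<le> h" for r h
  proof -
    obtain K where K: "\<And>w. w \<in> X \<Longrightarrow> norm (S r w) \<le> K * norm w"
      using bounded_operator[OF \<open>0 \<le> r\<close>] by metis
    have "((\<lambda>s. S r (S s w)) has_integral S r (F h)) {0..h}"
    proof (rule has_integral_linear_on_subspace[OF subspace closed, where T = "S r" and K = K])
      show "((\<lambda>s. S s w) has_integral F h) {0..h}"
        unfolding F_def by (intro integrable_integral integrable_continuous_real cont) simp
    qed (use \<open>0 \<le> r\<close> w in \<open>simp_all add: add scale K maps\<close>)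
    then have "S r (F h) = integral {0..h} (\<lambda>s. S r (S s w))"
      by (simp add: integral_unique)
    also have "\<dots> = integral {0..h} ((\<lambda>s. S s w) \<circ> (+) r)"
      using \<open>0 \<le> r\<close> w by (intro integral_cong) (simp add: at_add)
    also have "\<dots> = integral {r..h + r} (\<lambda>s. S s w)"
      by (simp add: integral_shift_Icc_real)
    also have "\<dots> = F (h + r) - F r"
      using Henstock_Kurzweil_Integration.integral_combine[where a = 0 and c = r and b = "h + r" and f = "\<lambda>s. S s w"] that
      by (simp add: F_def integrable_continuous_real cont algebra_simps)
    finally show ?thesis .
  qed
  have "((\<lambda>r. (F (0 + r) - F 0) /\<^sub>R r) \<longlongrightarrow> S 0 w) (at_right 0)"
    by (rule F_deriv) simp
  then have "((\<lambda>h. F h /\<^sub>R h) \<longlongrightarrow> w) (at_right 0)"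
    by (simp add: F0 at_zero w)
  moreover have "\<exists>v. (F h /\<^sub>R h, v) \<in> generator_graph X S" if "h > 0" for h
  proof -
    have "((\<lambda>r. ((F (h + r) - F h) /\<^sub>R r - (F (0 + r) - F 0) /\<^sub>R r) /\<^sub>R h)
        \<longlongrightarrow> (S h w - S 0 w) /\<^sub>R h) (at_right 0)"
      using that by (intro tendsto_intros F_deriv) auto
    moreover have "eventually (\<lambda>r. ((F (h + r) - F h) /\<^sub>R r - (F (0 + r) - F 0) /\<^sub>R r) /\<^sub>R h
        = (S r (F h /\<^sub>R h) - F h /\<^sub>R h) /\<^sub>R r) (at_right 0)"
      using eventually_at_right_less[of 0]
    proof eventually_elim
      case (elim r)
      then show ?case
        using that by (simp add: scale FX shift F0 algebra_simps)
    qed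
    ultimately have "((\<lambda>r. (S r (F h /\<^sub>R h) - F h /\<^sub>R h) /\<^sub>R r) \<longlongrightarrow> (S h w - S 0 w) /\<^sub>R h) (at_right 0)"
      by (simp add: tendsto_cong)
    moreover have "F h /\<^sub>R h \<in> X" "(S h w - S 0 w) /\<^sub>R h \<in> X"
      using that w FX by (auto intro!: subspace_scale[OF subspace] subspace_diff[OF subspace] maps)
    ultimately have "(F h /\<^sub>R h, (S h w - S 0 w) /\<^sub>R h) \<in> generator_graph X S"
      by (simp add: generator_graph_def)
    then show ?thesis
      by blast
  qed
  ultimately show thesis
    by (rule that)
qed

text \<open>
  Along the orbit \<open>u t = S t w\<close>, with generator \<open>A\<close>, dissipativity at the later time gives
  \<open>|u (t + h)| \<le> |u (t + h) - h A (u (t + h))|\<close>.  The right-hand side is the norm of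
  \<open>u t + o(h)\<close>, because the difference quotient of \<open>u\<close> at \<open>t\<close> and \<open>A (u (t + h)) = S (t + h) v\<close> both tend to
  \<open>A (u t)\<close>.  So the upper right derivative of \<open>|u|\<close> is nonpositive.
\<close>

lemma contraction_on_domain:
  assumes dissipative: "\<And>w v h. (w, v) \<in> generator_graph X S \<Longrightarrow> 0 \<le> h \<Longrightarrow> norm w \<le> norm (w - h *\<^sub>R v)"
    and wv: "(w, v) \<in> generator_graph X S" and "0 \<le> t"
  shows "norm (S t w) \<le> norm w"
proof -
  have w: "w \<in> X"
    using wv by (auto simp: generator_graph_def)
  have "norm (S t w) \<le> norm (S 0 w)"
  proof (rule nonincreasing_if_upper_derivative_nonpos[OF _ _ \<open>0 \<le> t\<close>])
    show "continuous_on {0..} (\<lambda>t. norm (S t w))"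
      by (intro continuous_intros continuous_orbit w)
    fix t e :: real
    assume "0 \<le> t" "0 < e"
    define p q where "p = S t w" and "q = S t v"
    have pq: "(p, q) \<in> generator_graph X S"
      unfolding p_def q_def by (rule generator_invariant[OF wv \<open>0 \<le> t\<close>])
    then have q: "q \<in> X" and lim: "((\<lambda>h. (S h p - p) /\<^sub>R h) \<longlongrightarrow> q) (at_right 0)"
      by (auto simp: generator_graph_def)
    have "((\<lambda>h. norm ((S h p - p) /\<^sub>R h - S h q)) \<longlongrightarrow> norm (q - q)) (at_right 0)"
      by (intro tendsto_intros lim tendsto_at_zero q)
    then have "eventually (\<lambda>h. norm ((S h p - p) /\<^sub>R h - S h q) < e) (at_right 0)"
      using \<open>0 < e\<close> by (intro order_tendstoD) simp_all
    moreover have "eventually (\<lambda>h :: real. h > 0) (at_right 0)"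
      by (rule eventually_at_right_less)
    ultimately show "eventually (\<lambda>h. norm (S (t + h) w) \<le> norm (S t w) + e * h) (at_right 0)"
    proof eventually_elim
      case (elim h)
      have "norm (S h p) \<le> norm (S h p - h *\<^sub>R S h q)"
        using elim by (intro dissipative generator_invariant[OF pq]) auto
      also have "S h p - h *\<^sub>R S h q = p + h *\<^sub>R ((S h p - p) /\<^sub>R h - S h q)"
        using elim by (simp add: algebra_simps)
      also have "norm \<dots> \<le> norm p + h * norm ((S h p - p) /\<^sub>R h - S h q)"
        using elim by (intro norm_triangle_le) simp
      also have "\<dots> \<le> norm p + e * h"
        using elim by (simp add: mult.commute)
      finally show ?case
        using elim \<open>0 \<le> t\<close> w at_add[of h t w] by (simp add: p_def add.commute)
    qed
  qed
  then show ?thesis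
    by (simp add: at_zero w)
qed

lemma contraction:
  assumes dissipative: "\<And>w v h. (w, v) \<in> generator_graph X S \<Longrightarrow> 0 \<le> h \<Longrightarrow> norm w \<le> norm (w - h *\<^sub>R v)"
    and w: "w \<in> X" and "0 \<le> t"
  shows "norm (S t w) \<le> norm w"
proof -
  obtain y where y: "(y \<longlongrightarrow> w) (at_right (0::real))"
    and gen: "\<And>h. h > 0 \<Longrightarrow> \<exists>v. (y h, v) \<in> generator_graph X S"
    using generator_domain_dense[OF w] by metis
  have pos: "eventually (\<lambda>h :: real. h > 0) (at_right 0)"
    by (rule eventually_at_right_less)
  have "eventually (\<lambda>h. y h \<in> X) (at_right 0)"
    using pos by eventually_elim (use gen in \<open>auto simp: generator_graph_def\<close>)
  then have "((\<lambda>h. norm (S t (y h))) \<longlongrightarrow> norm (S t w)) (at_right 0)"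
    by (intro tendsto_norm tendsto_operator[OF \<open>0 \<le> t\<close> y _ w])
  moreover have "((\<lambda>h. norm (y h)) \<longlongrightarrow> norm w) (at_right 0)"
    by (intro tendsto_norm y)
  moreover have "eventually (\<lambda>h. norm (S t (y h)) \<le> norm (y h)) (at_right 0)"
    using pos by eventually_elim (use gen contraction_on_domain[OF dissipative _ \<open>0 \<le> t\<close>] in blast)
  ultimately show ?thesis
    by (intro tendsto_le[OF trivial_limit_at_right_real])
qed

end

section \<open>The ETD1 step\<close>

text \<open>
  For a contraction semigroup the integrand is bounded by \<open>e\<^sup>-\<^sup>\<kappa>\<^sup>(\<^sup>\<tau>\<^sup>-\<^sup>s\<^sup>) \<kappa> c\<close>, which integrates to
  \<open>(1 - e\<^sup>-\<^sup>\<kappa>\<^sup>\<tau>) c\<close>: exactly what is missing from the bound \<open>e\<^sup>-\<^sup>\<kappa>\<^sup>\<tau> c\<close> for the homogeneous part of an ETD1 step.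
\<close>

lemma (in strongly_continuous_semigroup) exponential_integral:
  assumes contraction: "\<And>t w. 0 \<le> t \<Longrightarrow> w \<in> X \<Longrightarrow> norm (S t w) \<le> norm w"
    and N: "N \<in> X" "norm N \<le> \<kappa> * c" and "0 \<le> \<tau>"
  shows "integral {0..\<tau>} (\<lambda>s. exp (- \<kappa> * (\<tau> - s)) *\<^sub>R S (\<tau> - s) N) \<in> X"
    and "norm (integral {0..\<tau>} (\<lambda>s. exp (- \<kappa> * (\<tau> - s)) *\<^sub>R S (\<tau> - s) N)) \<le> (1 - exp (- \<kappa> * \<tau>)) * c"
proof -
  define f where "f = (\<lambda>s. exp (- \<kappa> * (\<tau> - s)) *\<^sub>R S (\<tau> - s) N)"
  have "continuous_on {0..\<tau>} f"
    unfolding f_def by (intro continuous_intros continuous_on_compose2[OF continuous_orbit[OF N(1)]]) auto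
  then have f: "f integrable_on {0..\<tau>}"
    by (rule integrable_continuous_real)
  have "integral {0..\<tau>} f \<in> X"
    by (rule has_integral_mem_closed_subspace[OF subspace closed _ integrable_integral[OF f]])
      (auto simp: f_def intro!: subspace_scale[OF subspace] maps N)
  then show "integral {0..\<tau>} (\<lambda>s. exp (- \<kappa> * (\<tau> - s)) *\<^sub>R S (\<tau> - s) N) \<in> X"
    by (simp only: f_def)
  have g: "((\<lambda>s. exp (- \<kappa> * (\<tau> - s)) * (\<kappa> * c)) has_integral
      exp (- \<kappa> * (\<tau> - \<tau>)) * c - exp (- \<kappa> * (\<tau> - 0)) * c) {0..\<tau>}"
    using \<open>0 \<le> \<tau>\<close>
    by (intro fundamental_theorem_of_calculus)
      (auto intro!: derivative_eq_intros simp flip: has_real_derivative_iff_has_vector_derivative)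
  have "norm (f s) \<le> exp (- \<kappa> * (\<tau> - s)) * (\<kappa> * c)" if "s \<in> {0..\<tau>}" for s
    using contraction[of "\<tau> - s" N] N that unfolding f_def norm_scaleR
    by (intro mult_mono) auto
  then have "norm (integral {0..\<tau>} f) \<le> integral {0..\<tau>} (\<lambda>s. exp (- \<kappa> * (\<tau> - s)) * (\<kappa> * c))"
    by (intro integral_norm_bound_integral f has_integral_integrable[OF g])
  then show "norm (integral {0..\<tau>} (\<lambda>s. exp (- \<kappa> * (\<tau> - s)) *\<^sub>R S (\<tau> - s) N)) \<le> (1 - exp (- \<kappa> * \<tau>)) * c"
    unfolding integral_unique[OF g] by (simp add: f_def left_diff_distrib)
qed

lemma bounded_linear_apply_bcontfun: "bounded_linear (\<lambda>W. apply_bcontfun W x)"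
  by (rule bounded_linear_intro[where K = 1]) (simp_all add: norm_bounded)

lemma subspace_periodic_matfun: "subspace (periodic_matfun :: 'm::finite matfun set)"
  by (simp add: subspace_def periodic_matfun_def)

lemma closed_periodic_matfun: "closed (periodic_matfun :: 'm::finite matfun set)"
  unfolding periodic_matfun_def
  by (intro closed_Collect_all closed_Collect_eq linear_continuous_on bounded_linear_apply_bcontfun)

lemma heat_semigroup_contraction:
  fixes W :: "'m::finite matfun"
  assumes S: "is_heat_semigroup \<epsilon> S" and "W \<in> periodic_matfun" "0 \<le> t"
  shows "norm (S t W) \<le> norm W"
proof -
  interpret strongly_continuous_semigroup periodic_matfun S
    using S by unfold_locales (simp_all add: subspace_periodic_matfun closed_periodic_matfun is_heat_semigroup_def)
  show ?thesis
    using S closure_heat_graph_dissipative assms(2,3) by (intro contraction) (auto simp: is_heat_semigroup_def)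
qed

text \<open>
  The new value is bounded by the convex combination \<open>e\<^sup>-\<^sup>\<kappa>\<^sup>\<tau> \<surd>m + (1 - e\<^sup>-\<^sup>\<kappa>\<^sup>\<tau>) \<surd>m\<close>, whatever \<open>\<tau>\<close> is.
\<close>

lemma ETD1_step_bound:
  fixes U :: "'m::finite matfun"
  assumes S: "is_heat_semigroup \<epsilon> S"
    and \<kappa>: "2 \<le> \<kappa>" "real CARD('m) \<le> 2 * \<kappa>" and "0 \<le> \<tau>"
    and U: "U \<in> periodic_matfun" "norm U \<le> sqrt (real CARD('m))"
  defines "V \<equiv> damped \<kappa> S \<tau> U + integral {0..\<tau>} (\<lambda>s. damped \<kappa> S (\<tau> - s) (nonlin \<kappa> U))"
  shows "V \<in> periodic_matfun \<and> norm V \<le> sqrt (real CARD('m))"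
proof -
  define c where "c = sqrt (real CARD('m))"
  interpret strongly_continuous_semigroup periodic_matfun S
    using S by unfold_locales (simp_all add: subspace_periodic_matfun closed_periodic_matfun is_heat_semigroup_def)
  have N: "nonlin \<kappa> U \<in> periodic_matfun"
    using U(1) by (simp add: periodic_matfun_def)
  have "norm (U x) \<le> sqrt (real CARD('m))" for x
    using norm_bounded[of U x] U(2) by simp
  then have N_le: "norm (nonlin \<kappa> U) \<le> \<kappa> * c"
    unfolding c_def by (intro norm_bound) (simp add: norm_stabilized_f_AC_le \<kappa>)
  note int = exponential_integral[OF heat_semigroup_contraction[OF S] N N_le \<open>0 \<le> \<tau>\<close>]
  have "V \<in> periodic_matfun"
    unfolding V_def damped_def using \<open>0 \<le> \<tau>\<close> U(1)
    by (intro subspace_add[OF subspace] subspace_scale[OF subspace] maps int(1))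
  moreover have "norm V \<le> exp (- \<kappa> * \<tau>) * c + (1 - exp (- \<kappa> * \<tau>)) * c"
    unfolding V_def damped_def
  proof (rule norm_triangle_mono[OF _ int(2)])
    have "norm (S \<tau> U) \<le> c"
      using heat_semigroup_contraction[OF S U(1) \<open>0 \<le> \<tau>\<close>] U(2) by (simp add: c_def)
    then show "norm (exp (- \<kappa> * \<tau>) *\<^sub>R S \<tau> U) \<le> exp (- \<kappa> * \<tau>) * c"
      by (simp add: mult_left_mono)
  qed
  ultimately show ?thesis
    by (simp add: c_def algebra_simps)
qed

text \<open>
  On periodic functions a bound on \<open>\<Omega>\<close> is a bound in the supremum norm, so the result is an
  induction over the steps.  The condition on \<open>\<kappa>\<close> enters through \<open>\<kappa> \<ge> 2\<close> and \<open>m \<le> 2 \<kappa>\<close>, the latter from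
  \<open>2 \<kappa> \<ge> 3 m - 2 \<ge> m\<close>.
\<close>

theorem theorem3p1:
  fixes S :: "real \<Rightarrow> 'm::finite matfun \<Rightarrow> 'm matfun"
    and U0 :: "'m matfun"
    and \<epsilon> \<kappa> :: real
  assumes "CARD('m) \<ge> 2"
    and "\<epsilon> > 0"
    and "\<kappa> > 0"
    and "is_heat_semigroup \<epsilon> S"
    and "U0 \<in> periodic_matfun"
    and "\<forall>x\<in>\<Omega>. norm (U0 x) \<le> sqrt (real CARD('m))"
    and "\<kappa> \<ge> max (3 / 2 * real CARD('m) - 1) 2"
  shows "\<forall>\<tau>>0. \<forall>n\<ge>1. \<forall>x\<in>\<Omega>.
    norm (ETD1 S \<kappa> \<tau> U0 n x) \<le> sqrt (real CARD('m))"
proof (intro allI impI ballI)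
  fix \<tau> :: real and n :: nat and x :: "real ^ 'm"
  assume "\<tau> > 0"
  have \<kappa>: "2 \<le> \<kappa>" "real CARD('m) \<le> 2 * \<kappa>"
    using assms(1,7) by auto
  have "norm U0 \<le> sqrt (real CARD('m))"
    using norm_periodic_matfun[OF assms(5)] assms(6) by metis
  then have "ETD1 S \<kappa> \<tau> U0 n \<in> periodic_matfun \<and> norm (ETD1 S \<kappa> \<tau> U0 n) \<le> sqrt (real CARD('m))"
    using assms(5) \<open>\<tau> > 0\<close> by (induction n) (simp_all add: ETD1_step_bound[OF assms(4) \<kappa>])
  then show "norm (ETD1 S \<kappa> \<tau> U0 n x) \<le> sqrt (real CARD('m))"
    using norm_bounded order_trans by blast
qed

end
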